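(* For any infinite abelian group $G$, $S_G(2)=3$.
   Context: For $A\subset G$ and a positive integer $h$, $hA$ is the set of sums of $h$ not necessarily distinct elements of $A$; $A\sim B$ means finite symmetric difference. $\operatorname{ord}^*_G(A)$ is the least $k$ with $kA\sim G$ ($\infty$ if none). $S_G(h)$ is the minimum value of $s$ such that for every $A\subset G$ with $hA\sim G$, there are only finitely many $a\in A$ with $\operatorname{ord}^*_G(A\setminus\{a\})>s$ (and $S_G(h)=\infty$ if no such $s$ exists). *)

theory Defs
  imports Main "HOL-Library.Extended_Nat"
begin

definition hfold_sum :: "nat \<Rightarrow> 'a::ab_group_add set \<Rightarrow> 'a set" where
  "hfold_sum h A = {sum_list xs | xs. length xs = h \<and> set xs \<subseteq> A}"

definition almost_eq :: "'a set \<Rightarrow> 'a set \<Rightarrow> bool" (infix "\<sim>\<^sub>f" 50) where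
  "A \<sim>\<^sub>f B \<longleftrightarrow> finite (sym_diff A B)"

(* Sets of naturals are embedded in enat so that the infimum is the minimum,
   or \<infinity> for the empty set. *)
definition ord_star :: "'a::ab_group_add set \<Rightarrow> enat" where
  "ord_star A = Inf {enat k | k. 0 < k \<and> hfold_sum k A \<sim>\<^sub>f UNIV}"

(* The group is the whole type 'a, passed as a type argument. *)
definition S_fun :: "'a::ab_group_add itself \<Rightarrow> nat \<Rightarrow> enat" where
  "S_fun G h = Inf {enat s | s. \<forall>A :: 'a set. hfold_sum h A \<sim>\<^sub>f UNIV \<longrightarrow>
      finite {a \<in> A. ord_star (A - {a}) > enat s}}"

end

theory Submission imports Defs "HOL-Library.Countable_Set" begin

text \<open>
  Upper bound: let \<open>2A \<sim> G\<close> and call \<open>a \<in> A\<close> bad if \<open>3(A \ {a})\<close> is not cofinite. If \<open>x\<close> lies outside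
  \<open>3(A \ {a})\<close>, then \<open>x - a - c \<in> A\<close> for almost all \<open>c \<in> A\<close>. Two such \<open>x\<close> yield some \<open>h \<noteq> 0\<close> with
  \<open>A + h \<sim> A\<close>. If \<open>a\<close> is bad with witness \<open>x\<close> and \<open>a + h \<in> A\<close>, then
  \<open>x = (a + h) + (c - h) + (x - a - c)\<close> for a suitable \<open>c\<close> contradicts the choice of \<open>x\<close>; so all bad
  elements lie in the finite set of \<open>c \<in> A\<close> with \<open>c + h \<notin> A\<close>.

  Lower bound: choose in a countable subgroup \<open>K\<close> a sequence \<open>D\<close> that is so thin that all
  relations among few of its terms are trivial, split off infinite subsequences \<open>P\<close>, \<open>Q\<close>, \<open>T\<close>, and put
  \<open>X = P + Q\<close>. For each coset \<open>E\<close> of \<open>K\<close>, the countable set \<open>E \<union> -E\<close> can be covered, up to \<open>X\<close>, by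
  \<open>U + T\<close> with a greedily chosen \<open>U \<subseteq> E \<union> -E\<close> such that \<open>U + U\<close> and \<open>U + D\<close> avoid \<open>X\<close>. Since
  \<open>X \<subseteq> K\<close>, sums of elements from different classes \<open>E \<union> -E\<close> avoid \<open>X\<close> as well. The union \<open>A\<close> of \<open>D\<close>
  with all the \<open>U\<close> satisfies \<open>2A = G\<close>, but \<open>p + q\<close> with \<open>p \<in> P\<close>, \<open>q \<in> Q\<close> is not in \<open>2(A \ {p})\<close>.
\<close>

section \<open>Sums of two and three elements\<close>

lemma mem_hfold_sum_2: "x \<in> hfold_sum 2 A \<longleftrightarrow> (\<exists>a\<in>A. \<exists>b\<in>A. x = a + b)"
proof
  assume "x \<in> hfold_sum 2 A"
  then show "\<exists>a\<in>A. \<exists>b\<in>A. x = a + b"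
    by (auto simp: hfold_sum_def numeral_2_eq_2 length_Suc_conv) blast
next
  assume "\<exists>a\<in>A. \<exists>b\<in>A. x = a + b"
  then obtain a b where "a \<in> A" "b \<in> A" "x = a + b" by blast
  then show "x \<in> hfold_sum 2 A"
    unfolding hfold_sum_def by (auto intro!: exI[of _ "[a, b]"])
qed

lemma mem_hfold_sum_3: "a \<in> A \<Longrightarrow> b \<in> A \<Longrightarrow> c \<in> A \<Longrightarrow> a + b + c \<in> hfold_sum 3 A"
  unfolding hfold_sum_def by (auto intro!: exI[of _ "[a, b, c]"] simp: add.assoc)

lemma almost_eq_UNIV_iff: "A \<sim>\<^sub>f UNIV \<longleftrightarrow> finite (- A)"
  by (simp add: almost_eq_def Compl_eq_Diff_UNIV)

lemma infinite_summand:
  assumes "infinite (UNIV :: 'a::ab_group_add set)" and "hfold_sum 2 (A :: 'a set) \<sim>\<^sub>f UNIV"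
  shows "infinite A"
proof
  assume "finite A"
  have "hfold_sum 2 A \<subseteq> (\<lambda>(a, b). a + b) ` (A \<times> A)"
    by (auto simp: mem_hfold_sum_2)
  with \<open>finite A\<close> have "finite (hfold_sum 2 A)"
    by (meson finite_SigmaI finite_imageI finite_subset)
  with assms show False
    by (simp add: almost_eq_UNIV_iff)
qed

section \<open>Upper bound: almost invariant reflections and translations\<close>

text \<open>For almost all \<open>c\<close> in \<open>A\<close>, \<open>x - c\<close> is a sum
  \<open>b + b'\<close> in \<open>2A\<close>. If \<open>c\<close>, \<open>b\<close>,
  \<open>b'\<close> all differed from \<open>a\<close>, then \<open>x\<close> would be in
  \<open>3(A - {a})\<close>. So, for \<open>c\<close> other than \<open>a\<close>, one of
  \<open>b\<close>, \<open>b'\<close> is \<open>a\<close> and the other is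
  \<open>x - a - c\<close>.\<close>

lemma reflection_almost_invariant:
  fixes A :: "'a::ab_group_add set"
  assumes basis: "hfold_sum 2 A \<sim>\<^sub>f UNIV" and x: "x \<notin> hfold_sum 3 (A - {a})"
  shows "finite {c \<in> A. x - a - c \<notin> A}"
proof -
  let ?F = "- hfold_sum 2 A"
  have "c \<in> insert a ((\<lambda>f. x - f) ` ?F)" if c: "c \<in> A" "x - a - c \<notin> A" for c
  proof (rule ccontr)
    assume *: "c \<notin> insert a ((\<lambda>f. x - f) ` ?F)"
    have "x - c \<in> hfold_sum 2 A"
    proof (rule ccontr)
      assume "x - c \<notin> hfold_sum 2 A"
      then have "x - (x - c) \<in> (\<lambda>f. x - f) ` ?F" by blast
      with * show False by simp
    qed
    then obtain b b' where b: "b \<in> A" "b' \<in> A" "x - c = b + b'"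
      by (auto simp: mem_hfold_sum_2)
    have "b \<noteq> a" "b' \<noteq> a"
      using b c by (auto simp: algebra_simps)
    then have "b + b' + c \<in> hfold_sum 3 (A - {a})"
      using b c * by (intro mem_hfold_sum_3) auto
    with b(3) x show False
      by (metis diff_add_cancel)
  qed
  then have "{c \<in> A. x - a - c \<notin> A} \<subseteq> insert a ((\<lambda>f. x - f) ` ?F)" by blast
  moreover have "finite (insert a ((\<lambda>f. x - f) ` ?F))"
    using basis by (simp add: almost_eq_UNIV_iff)
  ultimately show ?thesis by (rule finite_subset)
qed

text \<open>Reflecting by \<open>c -> y' - c\<close> and then by \<open>c -> y - c\<close> is
  translation by \<open>y - y'\<close>; an exceptional \<open>c\<close> fails at one of the two
  reflections.\<close>

lemma shift_almost_invariant:
  fixes A :: "'a::ab_group_add set"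
  assumes y: "finite {c \<in> A. y - c \<notin> A}" and y': "finite {c \<in> A. y' - c \<notin> A}"
  shows "finite {c \<in> A. c + (y - y') \<notin> A}"
proof -
  have "{c \<in> A. c + (y - y') \<notin> A} \<subseteq> {c \<in> A. y' - c \<notin> A} \<union> (\<lambda>c. y' - c) ` {c \<in> A. y - c \<notin> A}"
  proof
    fix c assume c: "c \<in> {c \<in> A. c + (y - y') \<notin> A}"
    have "c = y' - (y' - c)" "y - (y' - c) = c + (y - y')"
      by (simp_all add: algebra_simps)
    with c show "c \<in> {c \<in> A. y' - c \<notin> A} \<union> (\<lambda>c. y' - c) ` {c \<in> A. y - c \<notin> A}"
      by (metis (mono_tags, lifting) UnCI image_eqI mem_Collect_eq)
  qed
  then show ?thesis
    using assms by (meson finite_UnI finite_imageI finite_subset)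
qed

lemma finite_not_three_basis:
  fixes A :: "'a::ab_group_add set"
  assumes inf: "infinite (UNIV :: 'a set)" and basis: "hfold_sum 2 A \<sim>\<^sub>f UNIV"
  shows "finite {a \<in> A. \<not> hfold_sum 3 (A - {a}) \<sim>\<^sub>f UNIV}" (is "finite ?B")
proof (cases "?B = {}")
  case False
  then obtain a\<^sub>0 where "infinite (- hfold_sum 3 (A - {a\<^sub>0}))"
    by (auto simp: almost_eq_UNIV_iff)
  then obtain x x' where x: "x \<notin> hfold_sum 3 (A - {a\<^sub>0})" "x' \<notin> hfold_sum 3 (A - {a\<^sub>0})" "x \<noteq> x'"
    by (metis ComplD finite.emptyI infinite_arbitrarily_large
        insertI1 finite_insert is_singletonI' is_singleton_def)
  define h where "h = (x - a\<^sub>0) - (x' - a\<^sub>0)"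
  have "h \<noteq> 0" using x by (simp add: h_def)
  have shift: "finite {c \<in> A. c + h \<notin> A}"
    unfolding h_def by (intro shift_almost_invariant reflection_almost_invariant basis x)
  \<comment> \<open>Exchanging \<open>x\<close> and \<open>x'\<close> turns \<open>h\<close> into
    \<open>- h\<close>.\<close>
  have unshift: "finite {c \<in> A. c - h \<notin> A}"
    using shift_almost_invariant[OF reflection_almost_invariant[OF basis x(2)]
        reflection_almost_invariant[OF basis x(1)]]
    by (simp add: h_def algebra_simps)
  have "?B \<subseteq> {c \<in> A. c + h \<notin> A}"
  proof (rule ccontr)
    assume "\<not> ?B \<subseteq> {c \<in> A. c + h \<notin> A}"
    then obtain a where a: "a \<in> A" "a + h \<in> A" "infinite (- hfold_sum 3 (A - {a}))"
      by (auto simp: almost_eq_UNIV_iff)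
    from a(3) obtain v where v: "v \<notin> hfold_sum 3 (A - {a})"
      by (metis ComplD ex_in_conv finite.emptyI)
    \<comment> \<open>Outside the first two sets, \<open>v - a - c\<close> and \<open>c - h\<close>
      lie in \<open>A\<close>; the two extra points keep \<open>c - h\<close> and
      \<open>v - a - c\<close> different from \<open>a\<close>.\<close>
    let ?E = "{c \<in> A. v - a - c \<notin> A} \<union> {c \<in> A. c - h \<notin> A} \<union> {a + h, v - a - a}"
    have "finite ?E"
      using unshift reflection_almost_invariant[OF basis v] by simp
    then obtain c where c: "c \<in> A" "c \<notin> ?E"
      using infinite_summand[OF inf basis] by (meson finite_subset subsetI)
    then have "a + h + (c - h) + (v - a - c) \<in> hfold_sum 3 (A - {a})"
      using a \<open>h \<noteq> 0\<close> by (intro mem_hfold_sum_3) (auto simp: algebra_simps)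
    with v show False by (simp add: algebra_simps)
  qed
  with shift show ?thesis by (meson finite_subset)
qed (metis finite.emptyI)

section \<open>Countable subgroups\<close>

text \<open>The subgroup generated by \<open>S\<close> consists of the differences of finite sums
  over \<open>S\<close>, hence is an image of the countable set of pairs of lists.\<close>

lemma countable_subgroup_containing:
  fixes S :: "'a::ab_group_add set"
  assumes "countable S"
  obtains K where "countable K" "S \<subseteq> K" "0 \<in> K"
    "\<And>x y. x \<in> K \<Longrightarrow> y \<in> K \<Longrightarrow> x + y \<in> K" "\<And>x. x \<in> K \<Longrightarrow> - x \<in> K"
proof
  let ?L = "lists S \<times> lists S"
  let ?s = "\<lambda>(xs, ys). sum_list xs - sum_list ys"
  show "countable (?s ` ?L)"
    using assms by (intro countable_image countable_SIGMA countable_lists)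
  show "S \<subseteq> ?s ` ?L"
    by (force intro!: image_eqI[of _ _ "([x], [])" for x])
  show "0 \<in> ?s ` ?L"
    by (intro image_eqI[of _ _ "([], [])"]) auto
  show "x + y \<in> ?s ` ?L" if xy: "x \<in> ?s ` ?L" "y \<in> ?s ` ?L" for x y
  proof -
    obtain a b c d where "a \<in> lists S" "b \<in> lists S" "c \<in> lists S" "d \<in> lists S"
      "x = sum_list a - sum_list b" "y = sum_list c - sum_list d"
      using xy by auto
    then show ?thesis
      by (intro image_eqI[of _ _ "(a @ c, b @ d)"]) (auto simp: algebra_simps)
  qed
  show "- x \<in> ?s ` ?L" if x: "x \<in> ?s ` ?L" for x
  proof -
    obtain a b where "a \<in> lists S" "b \<in> lists S" "x = sum_list a - sum_list b"
      using x by auto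
    then show ?thesis
      by (intro image_eqI[of _ _ "(b, a)"]) auto
  qed
qed

text \<open>The last clause supplies the next term of a thin sequence at every stage. If there are
  infinitely many doubles, \<open>K\<close> is generated by preimages of infinitely many of
  them.\<close>

lemma countable_subgroup_avoiding_finite:
  assumes "infinite (UNIV :: 'a::ab_group_add set)"
  obtains K :: "'a::ab_group_add set" where "countable K" "0 \<in> K"
    "\<And>x y. x \<in> K \<Longrightarrow> y \<in> K \<Longrightarrow> x + y \<in> K" "\<And>x. x \<in> K \<Longrightarrow> - x \<in> K"
    "\<And>F. finite F \<Longrightarrow> \<exists>d\<in>K. d \<notin> F \<and> (infinite (range (\<lambda>g::'a::ab_group_add. g + g)) \<longrightarrow> d + d \<notin> F)"
proof -
  let ?dbl = "\<lambda>g::'a. g + g"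
  have "\<exists>S. countable S \<and> infinite S \<and> (infinite (range ?dbl) \<longrightarrow> infinite (?dbl ` S))"
  proof (cases "infinite (range ?dbl)")
    case True
    then obtain C where C: "C \<subseteq> range ?dbl" "countable C" "infinite C"
      using infinite_countable_subset' by blast
    have "?dbl ` inv ?dbl ` C = C"
      unfolding image_image using C(1) f_inv_into_f[of _ ?dbl UNIV] by (simp add: subset_iff)
    with C show ?thesis
      by (intro exI[of _ "inv ?dbl ` C"]) (metis countable_image finite_imageI)
  next
    case False
    with assms show ?thesis
      using infinite_countable_subset' by blast
  qed
  then obtain S where S: "countable S" "infinite S" "infinite (range ?dbl) \<Longrightarrow> infinite (?dbl ` S)"
    by blast
  obtain K where K: "countable K" "S \<subseteq> K" "0 \<in> K"
    "\<And>x y. x \<in> K \<Longrightarrow> y \<in> K \<Longrightarrow> x + y \<in> K" "\<And>x. x \<in> K \<Longrightarrow> - x \<in> K"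
    using countable_subgroup_containing[OF S(1)] by metis
  have "\<exists>d\<in>K. d \<notin> F \<and> (infinite (range ?dbl) \<longrightarrow> d + d \<notin> F)" if F: "finite F" for F
  proof (cases "infinite (range ?dbl)")
    case True
    \<comment> \<open>A double outside both \<open>F\<close> and the doubles of \<open>F\<close>
      comes from an element of \<open>S\<close> that is itself outside \<open>F\<close>, so one
      \<open>d\<close> meets both demands.\<close>
    then have "\<not> ?dbl ` S \<subseteq> F \<union> ?dbl ` F"
      using S(3) F by (meson finite_UnI finite_imageI finite_subset)
    then show ?thesis using K(2) by blast
  next
    case False
    have "\<not> S \<subseteq> F" using S(2) F finite_subset by blast
    with False K(2) show ?thesis by blast
  qed
  with K(1,3-5) show ?thesis by (rule that)
qed

section \<open>Thin sequences\<close>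

text \<open>Four summands are enough for every relation refuted below once it is solved for its term
  of largest index; with \<open>0\<close> in \<open>V\<close>, shorter sums are included.\<close>

definition sum4 :: "'a::ab_group_add set \<Rightarrow> 'a set" where
  "sum4 V = (\<lambda>(a, b, c, e). a + b + c + e) ` (V \<times> V \<times> V \<times> V)"

lemma sum4I: "a \<in> V \<Longrightarrow> b \<in> V \<Longrightarrow> c \<in> V \<Longrightarrow> e \<in> V \<Longrightarrow> a + b + c + e \<in> sum4 V"
  by (force simp: sum4_def)

lemma finite_sum4: "finite V \<Longrightarrow> finite (sum4 V)"
  by (simp add: sum4_def)

text \<open>
  Here \<open>Q\<close> stands for the case that there are infinitely many elements \<open>g + g\<close>. In the opposite case a
  condition on \<open>d n + d n\<close> may be unsatisfiable, and \<open>H\<close> is taken to be the set of all \<open>g + g\<close> instead.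
\<close>

lemma thin_sequence_exists:
  fixes K :: "'a::ab_group_add set" and w :: "nat \<Rightarrow> 'a"
  assumes avoid: "\<And>F. finite F \<Longrightarrow> \<exists>d\<in>K. d \<notin> F \<and> (Q \<longrightarrow> d + d \<notin> F)"
    and H: "finite H"
  obtains d :: "nat \<Rightarrow> 'a" and V :: "nat \<Rightarrow> 'a set" where
    "\<And>n. d n \<in> K" "\<And>n. d n \<notin> sum4 (V n)" "\<And>n. Q \<Longrightarrow> d n + d n \<notin> sum4 (V n)"
    "\<And>n. 0 \<in> V n" "\<And>n. H \<subseteq> V n" "\<And>n v. v \<in> V n \<Longrightarrow> - v \<in> V n"
    "\<And>m n. m \<le> n \<Longrightarrow> w m \<in> V n" "\<And>m n. m < n \<Longrightarrow> d m \<in> V n"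
proof -
  \<comment> \<open>A state is the pair of \<open>V n\<close> and \<open>d n\<close>; its finiteness
    lets the next stage absorb both into \<open>V (Suc n)\<close>.\<close>
  define P where "P n s \<longleftrightarrow> finite (fst s) \<and> 0 \<in> fst s \<and> H \<subseteq> fst s \<and> (\<forall>v\<in>fst s. - v \<in> fst s)
      \<and> w n \<in> fst s \<and> snd s \<in> K \<and> snd s \<notin> sum4 (fst s)
      \<and> (Q \<longrightarrow> snd s + snd s \<notin> sum4 (fst s))" for n and s :: "'a set \<times> 'a"
  have ext: "\<exists>s. P n s \<and> S \<subseteq> fst s" if S: "finite S" for n S
  proof -
    define S' where "S' = {0} \<union> (H \<union> uminus ` H) \<union> (S \<union> uminus ` S) \<union> {w n, - w n}"
    have "finite S'" using S H by (simp add: S'_def)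
    then obtain d where "d \<in> K" "d \<notin> sum4 S'" "Q \<longrightarrow> d + d \<notin> sum4 S'"
      using avoid[OF finite_sum4] by blast
    with \<open>finite S'\<close> have "P n (S', d)" by (auto simp: P_def S'_def)
    then show ?thesis by (intro exI[of _ "(S', d)"]) (auto simp: S'_def)
  qed
  have "\<exists>f. \<forall>n. P n (f n) \<and> insert (snd (f n)) (fst (f n)) \<subseteq> fst (f (Suc n))"
  proof (rule dependent_nat_choice)
    show "\<exists>s. P 0 s" using ext[of "{}"] by blast
    show "\<exists>s'. P (Suc n) s' \<and> insert (snd s) (fst s) \<subseteq> fst s'" if "P n s" for s n
      using that by (intro ext) (simp add: P_def)
  qed
  then obtain f where f: "\<And>n. P n (f n)" "\<And>n. insert (snd (f n)) (fst (f n)) \<subseteq> fst (f (Suc n))"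
    by blast
  have mono: "fst (f m) \<subseteq> fst (f n)" if "m \<le> n" for m n
    using lift_Suc_mono_le[of "\<lambda>n. fst (f n)", OF _ that] f(2) by blast
  show ?thesis
  proof (rule that[of "\<lambda>n. snd (f n)" "\<lambda>n. fst (f n)"])
    show "w m \<in> fst (f n)" if "m \<le> n" for m n
      using f(1)[of m] mono[OF that] by (auto simp: P_def)
    show "snd (f m) \<in> fst (f n)" if "m < n" for m n
      using f(2)[of m] mono[of "Suc m" n] that by auto
  qed (use f(1) in \<open>auto simp: P_def\<close>)
qed

section \<open>Greedy covering\<close>

text \<open>The points of \<open>M - X\<close> are treated one after another, adding
  \<open>u = z - t\<close> for a suitable \<open>t\<close> in \<open>T\<close>. In the application
  \<open>T\<close> lies in \<open>D\<close>, so \<open>e = t\<close> gives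
  \<open>z - t + e = z\<close>; this is why \<open>base\<close> is restricted to \<open>z\<close>
  outside \<open>X\<close>.\<close>

lemma covering_set_avoiding_sums:
  fixes T X D M :: "'a::ab_group_add set"
  assumes T: "infinite T" and M: "countable M"
    and one: "\<And>z. finite {t \<in> T. z - t \<in> X}"
    and dbl: "\<And>z. finite {t \<in> T. (z - t) + (z - t) \<in> X}"
    and base: "\<And>z. z \<notin> X \<Longrightarrow> finite {t \<in> T. \<exists>d\<in>D. z - t + d \<in> X}"
  obtains U where "U \<subseteq> (\<lambda>(z, t). z - t) ` (M \<times> T)" "\<And>z. z \<in> M - X \<Longrightarrow> \<exists>u\<in>U. \<exists>t\<in>T. z = u + t"
    "\<And>u d. u \<in> U \<Longrightarrow> d \<in> D \<Longrightarrow> u + d \<notin> X" "\<And>u u'. u \<in> U \<Longrightarrow> u' \<in> U \<Longrightarrow> u + u' \<notin> X"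
proof (cases "M - X = {}")
  case True
  then show ?thesis using that[of "{}"] by auto
next
  case False
  define z where "z = from_nat_into (M - X)"
  have z: "range z = M - X"
    unfolding z_def using False M by (intro range_from_nat_into countable_Diff)
  define P where "P S \<longleftrightarrow> finite S \<and> S \<subseteq> (\<lambda>(z, t). z - t) ` (M \<times> T)
      \<and> (\<forall>u\<in>S. \<forall>d\<in>D. u + d \<notin> X) \<and> (\<forall>u\<in>S. \<forall>u'\<in>S. u + u' \<notin> X)" for S
  have "\<exists>f. \<forall>n. P (f n) \<and> (f n \<subseteq> f (Suc n) \<and> (\<exists>u\<in>f (Suc n). \<exists>t\<in>T. z n = u + t))"
  proof (rule dependent_nat_choice)
    show "\<exists>S. P S" by (intro exI[of _ "{}"]) (simp add: P_def)
    show "\<exists>S'. P S' \<and> (S \<subseteq> S' \<and> (\<exists>u\<in>S'. \<exists>t\<in>T. z n = u + t))" if S: "P S" for S n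
    proof -
      have zn: "z n \<in> M" "z n \<notin> X" using z by auto
      \<comment> \<open>The three finite sets of bad \<open>t\<close> concern sums of the new
        element with the earlier ones, with itself, and with \<open>D\<close>.\<close>
      let ?E = "(\<Union>u\<in>S. {t \<in> T. (z n + u) - t \<in> X}) \<union> {t \<in> T. (z n - t) + (z n - t) \<in> X}
        \<union> {t \<in> T. \<exists>d\<in>D. z n - t + d \<in> X}"
      have "finite ?E"
        using S one dbl base[OF zn(2)] by (simp add: P_def)
      then obtain t where t: "t \<in> T" "t \<notin> ?E"
        using T by (meson finite_subset subsetI)
      have "z n - t + u \<notin> X" "u + (z n - t) \<notin> X" if "u \<in> S" for u
        using t that by (auto simp: algebra_simps)
      then have "P (insert (z n - t) S)"
        using S t zn unfolding P_def by auto
      then show ?thesis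
        using t by (intro exI[of _ "insert (z n - t) S"]) auto
    qed
  qed
  then obtain f where f: "\<And>n. P (f n)" "\<And>n. f n \<subseteq> f (Suc n)"
    "\<And>n. \<exists>u\<in>f (Suc n). \<exists>t\<in>T. z n = u + t" by blast
  have mono: "f m \<subseteq> f n" if "m \<le> n" for m n
    using lift_Suc_mono_le[of f, OF _ that] f(2) by blast
  show ?thesis
  proof (rule that[of "\<Union>n. f n"])
    show "(\<Union>n. f n) \<subseteq> (\<lambda>(z, t). z - t) ` (M \<times> T)"
      using f(1) unfolding P_def by blast
    show "\<exists>u\<in>\<Union>n. f n. \<exists>t\<in>T. y = u + t" if "y \<in> M - X" for y
      using f(3) that z by (metis UN_I UNIV_I imageE)
    show "u + d \<notin> X" if "u \<in> (\<Union>n. f n)" "d \<in> D" for u d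
      using f(1) that by (auto simp: P_def)
    show "u + u' \<notin> X" if u: "u \<in> (\<Union>n. f n)" "u' \<in> (\<Union>n. f n)" for u u'
    proof -
      obtain m n where "u \<in> f m" "u' \<in> f n" using u by blast
      then have "u \<in> f (max m n)" "u' \<in> f (max m n)" using mono by (meson max.cobounded1 max.cobounded2 subsetD)+
      then show ?thesis using f(1)[of "max m n"] by (auto simp: P_def)
    qed
  qed
qed

section \<open>The sets P, Q and T inside a thin sequence\<close>

text \<open>A forbidden relation is solved for its term of largest index \<open>n\<close>, so that
  \<open>d n\<close> or its double would lie in \<open>sum4 (V n)\<close>. Residues mod 3 keep the
  indices of \<open>P\<close>, \<open>Q\<close>, \<open>T\<close> apart. For a target
  \<open>w m\<close>, only finitely many \<open>t\<close>, those of index below \<open>m\<close>,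
  can then be exceptional.\<close>

lemma thin_system_exists:
  assumes inf: "infinite (UNIV :: 'a::ab_group_add set)"
  obtains K P Q T D :: "'a::ab_group_add set" where "countable K" "0 \<in> K"
    "\<And>x y. x \<in> K \<Longrightarrow> y \<in> K \<Longrightarrow> x + y \<in> K" "\<And>x. x \<in> K \<Longrightarrow> - x \<in> K"
    "P \<union> Q \<union> T \<subseteq> D" "D \<subseteq> K" "infinite P" "infinite Q" "infinite T"
    "\<And>p q e e'. p \<in> P \<Longrightarrow> q \<in> Q \<Longrightarrow> e \<in> D - {p} \<Longrightarrow> e' \<in> D - {p} \<Longrightarrow> p + q \<noteq> e + e'"
    "\<And>z. finite {t \<in> T. z - t \<in> {p + q | p q. p \<in> P \<and> q \<in> Q}}"
    "\<And>z. finite {t \<in> T. (z - t) + (z - t) \<in> {p + q | p q. p \<in> P \<and> q \<in> Q}}"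
    "\<And>z. z \<notin> {p + q | p q. p \<in> P \<and> q \<in> Q} \<Longrightarrow>
      finite {t \<in> T. \<exists>e\<in>D. z - t + e \<in> {p + q | p q. p \<in> P \<and> q \<in> Q}}"
proof -
  let ?G2 = "range (\<lambda>g::'a. g + g)"
  obtain K :: "'a set" where K: "countable K" "0 \<in> K"
    "\<And>x y. x \<in> K \<Longrightarrow> y \<in> K \<Longrightarrow> x + y \<in> K" "\<And>x. x \<in> K \<Longrightarrow> - x \<in> K"
    and avoid: "\<And>F. finite F \<Longrightarrow> \<exists>d\<in>K. d \<notin> F \<and> (infinite ?G2 \<longrightarrow> d + d \<notin> F)"
    by (rule countable_subgroup_avoiding_finite[OF inf]) (rule that)
  define w where "w = from_nat_into K"
  have w: "range w = K"
    unfolding w_def using K(1,2) by (intro range_from_nat_into) auto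
  \<comment> \<open>If there are only finitely many doubles, all of them enter every
    \<open>V n\<close>, so no sum of two different terms is a double.\<close>
  define H where "H = (if finite ?G2 then ?G2 else {})"
  have "finite H" by (simp add: H_def)
  obtain d V where dK: "\<And>n. d n \<in> K" and d4: "\<And>n. d n \<notin> sum4 (V n)"
    and dd4: "\<And>n. infinite ?G2 \<Longrightarrow> d n + d n \<notin> sum4 (V n)"
    and V0: "\<And>n. 0 \<in> V n" and VH: "\<And>n. H \<subseteq> V n" and Vn: "\<And>n v. v \<in> V n \<Longrightarrow> - v \<in> V n"
    and Vw: "\<And>m n. m \<le> n \<Longrightarrow> w m \<in> V n" and Vd: "\<And>m n. m < n \<Longrightarrow> d m \<in> V n"
    using thin_sequence_exists[where K = K and w = w, OF avoid \<open>finite H\<close>] by blast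
  have not4: "d n \<noteq> a + b + c + e" if "a \<in> V n" "b \<in> V n" "c \<in> V n" "e \<in> V n" for n a b c e
    using d4[of n] sum4I[OF that] by metis
  have not4d: "d n + d n \<noteq> a + b + c + e"
    if "infinite ?G2" "a \<in> V n" "b \<in> V n" "c \<in> V n" "e \<in> V n" for n a b c e
    using dd4[of n] sum4I[OF that(2-)] that(1) by metis
  note Vs = V0 Vn Vd
  have "d m \<noteq> d n" if "m < n" for m n
    using not4[of "d m" n 0 0 0] that Vs by auto
  then have inj: "inj d"
    by (metis injI linorder_neqE_nat)
  \<comment> \<open>Since \<open>m \<le> l\<close>, the element \<open>w m\<close> is already in
    \<open>V n\<close> for the largest index \<open>n\<close> occurring; \<open>three\<close>,
    \<open>four\<close> and \<open>double\<close> use the same bound.\<close>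
  have two: "d l + d i \<noteq> w m" if "l \<noteq> i" "m \<le> l" for l i m
  proof
    assume eq: "d l + d i = w m"
    have wV: "w m \<in> V n" if "l \<le> n" for n using Vw that \<open>m \<le> l\<close> by (meson le_trans)
    have "d l = w m + - d i + 0 + 0" "d i = w m + - d l + 0 + 0"
      using eq by (auto simp: algebra_simps)
    moreover have "i < l \<or> l < i" using that by linarith
    ultimately show False
      using not4[of "w m" l "- d i" 0 0] not4[of "w m" i "- d l" 0 0] by (blast intro: Vs wV less_imp_le)
  qed
  have three: "d l + d i + d j \<noteq> w m" if "l \<noteq> i" "l \<noteq> j" "i \<noteq> j" "m \<le> l" for l i j m
  proof
    assume eq: "d l + d i + d j = w m"
    have wV: "w m \<in> V n" if "l \<le> n" for n using Vw that \<open>m \<le> l\<close> by (meson le_trans)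
    have "d l = w m + - d i + - d j + 0" "d i = w m + - d l + - d j + 0" "d j = w m + - d l + - d i + 0"
      using eq by (auto simp: algebra_simps)
    moreover have "i < l \<and> j < l \<or> l < i \<and> j < i \<or> l < j \<and> i < j" using that by linarith
    ultimately show False
      using not4[of "w m" l "- d i" "- d j" 0] not4[of "w m" i "- d l" "- d j" 0]
        not4[of "w m" j "- d l" "- d i" 0] by (blast intro: Vs wV less_imp_le)
  qed
  have four: "d l + d i + d j \<noteq> w m + d k"
    if "l \<noteq> i" "l \<noteq> j" "i \<noteq> j" "k \<noteq> i" "k \<noteq> j" "k \<noteq> l" "m \<le> l" for l i j k m
  proof
    assume eq: "d l + d i + d j = w m + d k"
    have wV: "w m \<in> V n" if "l \<le> n" for n using Vw that \<open>m \<le> l\<close> by (meson le_trans)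
    have "d l = w m + d k + - d i + - d j" "d i = w m + d k + - d l + - d j"
      "d j = w m + d k + - d l + - d i" "d k = - w m + d l + d i + d j"
      using eq by (auto simp: algebra_simps)
    moreover have "i < l \<and> j < l \<and> k < l \<or> l < i \<and> j < i \<and> k < i \<or> l < j \<and> i < j \<and> k < j
      \<or> l < k \<and> i < k \<and> j < k" using that by linarith
    ultimately show False
      using not4[of "w m" l "d k" "- d i" "- d j"] not4[of "w m" i "d k" "- d l" "- d j"]
        not4[of "w m" j "d k" "- d l" "- d i"] not4[of "- w m" k "d l" "d i" "d j"] by (blast intro: Vs wV less_imp_le)
  qed
  have not_G2: "d i + d j \<noteq> g + g" if "finite ?G2" "i \<noteq> j" for i j g
  proof
    assume eq: "d i + d j = g + g"
    have "g + g \<in> V n" for n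
      using VH[of n] that(1) by (auto simp: H_def)
    moreover have "d i = (g + g) + - d j + 0 + 0" "d j = (g + g) + - d i + 0 + 0"
      using eq by (auto simp: algebra_simps)
    moreover have "i < j \<or> j < i" using that by linarith
    ultimately show False
      using not4[of "g + g" i "- d j" 0 0] not4[of "g + g" j "- d i" 0 0] by (blast intro: Vs)
  qed
  have double: "(d l + d l) + (d i + d j) \<noteq> w m"
    if m: "m \<le> l" "w m = g + g" and ne: "l \<noteq> i" "l \<noteq> j" "i \<noteq> j" for l i j m g
  proof
    assume eq: "(d l + d l) + (d i + d j) = w m"
    have wV: "w m \<in> V n" if "l \<le> n" for n using Vw that \<open>m \<le> l\<close> by (meson le_trans)
    \<comment> \<open>With finitely many doubles, \<open>d i + d j\<close> would be the double of
      \<open>g - d l\<close>. Otherwise, if \<open>l\<close> is the largest index, the condition on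
      \<open>d l + d l\<close> applies.\<close>
    show False
    proof (cases "finite ?G2")
      case True
      have "d i + d j = (g - d l) + (g - d l)"
        using eq m(2) by (simp add: algebra_simps)
      with not_G2[OF True ne(3)] show False by blast
    next
      case False
      have "d l + d l = w m + - d i + - d j + 0" "d i = w m + - d l + - d l + - d j"
        "d j = w m + - d l + - d l + - d i"
        using eq by (auto simp: algebra_simps)
      moreover have "i < l \<and> j < l \<or> l < i \<and> j < i \<or> l < j \<and> i < j" using ne by linarith
      ultimately show False
        using not4d[OF False, of "w m" l "- d i" "- d j" 0] not4[of "w m" i "- d l" "- d l" "- d j"]
          not4[of "w m" j "- d l" "- d l" "- d i"] by (blast intro: Vs wV less_imp_le)
    qed
  qed
  have unique: "d i + d j \<noteq> d k + d k'" if ne: "i \<noteq> j" "k \<noteq> i" "k' \<noteq> i" for i j k k'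
  proof
    assume eq: "d i + d j = d k + d k'"
    \<comment> \<open>If one of \<open>k\<close>, \<open>k'\<close> were \<open>j\<close>,
      cancelling \<open>d j\<close> would make the other equal to \<open>i\<close>.\<close>
    have "k \<noteq> j" "k' \<noteq> j"
      using eq ne inj by (auto simp: add.commute inj_eq)
    show False
    proof (cases "k = k'")
      case False
      have "d i = d k + d k' + - d j + 0" "d j = d k + d k' + - d i + 0"
        "d k = d i + d j + - d k' + 0" "d k' = d i + d j + - d k + 0"
        using eq by (auto simp: algebra_simps)
      moreover have "j < i \<and> k < i \<and> k' < i \<or> i < j \<and> k < j \<and> k' < j \<or> i < k \<and> j < k \<and> k' < k
          \<or> i < k' \<and> j < k' \<and> k < k'"
        using ne False \<open>k \<noteq> j\<close> \<open>k' \<noteq> j\<close> by linarith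
      ultimately show False
        using not4[of "d k" i "d k'" "- d j" 0] not4[of "d k" j "d k'" "- d i" 0]
          not4[of "d i" k "d j" "- d k'" 0] not4[of "d i" k' "d j" "- d k" 0] by (blast intro: Vs)
    next
      case True
      show False
      proof (cases "finite ?G2")
        case fin: True
        with not_G2 ne eq True show False by metis
      next
        case fin: False
        have "d k + d k = d i + d j + 0 + 0" "d i = d k + d k + - d j + 0" "d j = d k + d k + - d i + 0"
          using eq True by (auto simp: algebra_simps)
        moreover have "i < k \<and> j < k \<or> j < i \<and> k < i \<or> i < j \<and> k < j"
          using ne \<open>k \<noteq> j\<close> by linarith
        ultimately show False
          using not4d[OF fin, of "d i" k "d j" 0 0] not4[of "d k" i "d k" "- d j" 0]
            not4[of "d k" j "d k" "- d i" 0] by (blast intro: Vs)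
      qed
    qed
  qed
  define P where "P = range (\<lambda>n. d (3 * n))"
  define Q where "Q = range (\<lambda>n. d (3 * n + 1))"
  define T where "T = range (\<lambda>n. d (3 * n + 2))"
  let ?X = "{p + q | p q. p \<in> P \<and> q \<in> Q}"
  have idx: "3 * l + 2 \<noteq> 3 * i" "3 * l + 2 \<noteq> 3 * j + 1" "3 * i \<noteq> 3 * j + 1" for i j l :: nat
    by presburger+
  have "infinite (range (\<lambda>n. d (3 * n + r)))" for r
    by (intro range_inj_infinite injI) (simp add: inj_eq[OF inj])
  from this[of 0] this[of 1] this[of 2] have infs: "infinite P" "infinite Q" "infinite T"
    by (simp_all add: P_def Q_def T_def)
  have XK: "?X \<subseteq> K"
    using dK K(3) by (auto simp: P_def Q_def)
  have one: "finite {t \<in> T. z - t \<in> ?X}" for z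
  proof (cases "z \<in> K")
    case False
    have "{t \<in> T. z - t \<in> ?X} = {}"
    proof (rule ccontr)
      assume "{t \<in> T. z - t \<in> ?X} \<noteq> {}"
      then obtain t where t: "t \<in> T" "z - t \<in> ?X" by blast
      then have "z - t \<in> K" "t \<in> K" using XK dK by (auto simp: T_def)
      with K(3)[of "z - t" t] False show False by simp
    qed
    then show ?thesis by (simp only: finite.emptyI)
  next
    case True
    then obtain m where m: "z = w m" using w by blast
    have "{t \<in> T. z - t \<in> ?X} \<subseteq> d ` {..<m}"
    proof
      fix t assume "t \<in> {t \<in> T. z - t \<in> ?X}"
      then obtain l i j where lij: "t = d (3 * l + 2)" "z - t = d (3 * i) + d (3 * j + 1)"
        by (auto simp: P_def Q_def T_def)
      then have "w m = d (3 * l + 2) + d (3 * i) + d (3 * j + 1)"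
        using m by (simp add: algebra_simps)
      then have "3 * l + 2 < m"
        using three[OF idx] by (metis leI)
      then show "t \<in> d ` {..<m}" using lij by blast
    qed
    then show ?thesis by (rule finite_subset) simp
  qed
  have dbl: "finite {t \<in> T. (z - t) + (z - t) \<in> ?X}" for z
  \<comment> \<open>The case split is on \<open>z + z\<close>, which may lie in \<open>K\<close>
    although \<open>z\<close> does not.\<close>
  proof (cases "z + z \<in> K")
    case False
    have "{t \<in> T. (z - t) + (z - t) \<in> ?X} = {}"
    proof (rule ccontr)
      assume "{t \<in> T. (z - t) + (z - t) \<in> ?X} \<noteq> {}"
      then obtain t where t: "t \<in> T" "(z - t) + (z - t) \<in> ?X" by blast
      then have "(z - t) + (z - t) \<in> K" "t \<in> K" using XK dK by (auto simp: T_def)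
      then have "(z - t) + (z - t) + (t + t) \<in> K" using K(3) by blast
      with False show False by (simp add: algebra_simps)
    qed
    then show ?thesis by (simp only: finite.emptyI)
  next
    case True
    then obtain m where m: "w m = z + z" using w by (metis imageE)
    have "{t \<in> T. (z - t) + (z - t) \<in> ?X} \<subseteq> d ` {..<m}"
    proof
      fix t assume "t \<in> {t \<in> T. (z - t) + (z - t) \<in> ?X}"
      then obtain l i j where lij: "t = d (3 * l + 2)"
        "(z - t) + (z - t) = d (3 * i) + d (3 * j + 1)"
        by (auto simp: P_def Q_def T_def)
      have "(d (3 * l + 2) + d (3 * l + 2)) + (d (3 * i) + d (3 * j + 1)) = w m"
        unfolding lij(2)[symmetric] lij(1) m by (simp add: algebra_simps)
      then have "3 * l + 2 < m"
        using double[OF _ m idx] by (metis leI)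
      then show "t \<in> d ` {..<m}" using lij by blast
    qed
    then show ?thesis by (rule finite_subset) simp
  qed
  have base: "finite {t \<in> T. \<exists>e\<in>range d. z - t + e \<in> ?X}" if z: "z \<notin> ?X" for z
  proof (cases "z \<in> K")
    case False
    have "{t \<in> T. \<exists>e\<in>range d. z - t + e \<in> ?X} = {}"
    proof (rule ccontr)
      assume "{t \<in> T. \<exists>e\<in>range d. z - t + e \<in> ?X} \<noteq> {}"
      then obtain t e where t: "t \<in> T" "e \<in> range d" "z - t + e \<in> ?X" by blast
      then have "z - t + e \<in> K" "t \<in> K" "e \<in> K" using XK dK by (auto simp: T_def)
      then have "z - t + e + t + - e \<in> K" using K(3,4) by blast
      with False show False by (simp add: algebra_simps)
    qed
    then show ?thesis by (simp only: finite.emptyI)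
  next
    case True
    then obtain m where m: "z = w m" using w by blast
    have "{t \<in> T. \<exists>e\<in>range d. z - t + e \<in> ?X} \<subseteq> d ` {..<m}"
    proof
      fix t assume "t \<in> {t \<in> T. \<exists>e\<in>range d. z - t + e \<in> ?X}"
      then obtain l i j k where lij: "t = d (3 * l + 2)"
        "z - t + d k = d (3 * i) + d (3 * j + 1)"
        by (auto simp: P_def Q_def T_def)
      then have eq: "d (3 * l + 2) + d (3 * i) + d (3 * j + 1) = w m + d k"
        using m by (simp add: algebra_simps)
      have "3 * l + 2 < m"
      proof (rule ccontr)
        assume "\<not> 3 * l + 2 < m"
        then have le: "m \<le> 3 * l + 2" by simp
        \<comment> \<open>The term \<open>d k\<close> may cancel against one on the left. Cancelling
          \<open>t\<close> would put \<open>z\<close> into \<open>X\<close>; the other cancellations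
          leave a relation excluded by \<open>two\<close>.\<close>
        consider "k = 3 * l + 2" | "k = 3 * i" | "k = 3 * j + 1"
          | "k \<noteq> 3 * i" "k \<noteq> 3 * j + 1" "k \<noteq> 3 * l + 2" by blast
        then show False
        proof cases
          case 1
          then have "z = d (3 * i) + d (3 * j + 1)" using eq m by (simp add: algebra_simps)
          with z show False by (auto simp: P_def Q_def)
        next
          case 2
          then have "d (3 * l + 2) + d (3 * j + 1) = w m" using eq by (simp add: algebra_simps)
          with two[OF idx(2) le] show False by blast
        next
          case 3
          then have "d (3 * l + 2) + d (3 * i) = w m" using eq by (simp add: algebra_simps)
          with two[OF idx(1) le] show False by blast
        next
          case 4
          with four[OF idx 4 le] eq show False by blast
        qed
      qed
      then show "t \<in> d ` {..<m}" using lij by blast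
    qed
    then show ?thesis by (rule finite_subset) simp
  qed
  show ?thesis
  proof (rule that[of K P Q T "range d"])
    show "P \<union> Q \<union> T \<subseteq> range d" by (auto simp: P_def Q_def T_def)
    show "range d \<subseteq> K" using dK by blast
    show "p + q \<noteq> e + e'" if pq: "p \<in> P" "q \<in> Q" "e \<in> range d - {p}" "e' \<in> range d - {p}" for p q e e'
    proof -
      obtain i j k k' where "p = d (3 * i)" "q = d (3 * j + 1)" "e = d k" "e' = d k'"
        using pq by (auto simp: P_def Q_def)
      moreover have "k \<noteq> 3 * i" "k' \<noteq> 3 * i" using pq calculation by auto
      ultimately show ?thesis using unique[OF idx(3)] by simp
    qed
  qed (use K infs one dbl base in auto)
qed

section \<open>Lower bound: gluing the pieces over classes of cosets\<close>

lemma two_basis_with_infinitely_many_essential: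
  assumes inf: "infinite (UNIV :: 'a::ab_group_add set)"
  obtains A :: "'a::ab_group_add set" where "hfold_sum 2 A = UNIV"
    "infinite {a \<in> A. \<not> hfold_sum 2 (A - {a}) \<sim>\<^sub>f UNIV}"
proof -
  obtain K P Q T D :: "'a set" where K: "countable K" "0 \<in> K"
    "\<And>x y. x \<in> K \<Longrightarrow> y \<in> K \<Longrightarrow> x + y \<in> K" "\<And>x. x \<in> K \<Longrightarrow> - x \<in> K"
    and D: "P \<union> Q \<union> T \<subseteq> D" "D \<subseteq> K" and infs: "infinite P" "infinite Q" "infinite T"
    and uniq: "\<And>p q e e'. p \<in> P \<Longrightarrow> q \<in> Q \<Longrightarrow> e \<in> D - {p} \<Longrightarrow> e' \<in> D - {p} \<Longrightarrow> p + q \<noteq> e + e'"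
    and thin: "\<And>z. finite {t \<in> T. z - t \<in> {p + q | p q. p \<in> P \<and> q \<in> Q}}"
    "\<And>z. finite {t \<in> T. (z - t) + (z - t) \<in> {p + q | p q. p \<in> P \<and> q \<in> Q}}"
    "\<And>z. z \<notin> {p + q | p q. p \<in> P \<and> q \<in> Q} \<Longrightarrow>
      finite {t \<in> T. \<exists>e\<in>D. z - t + e \<in> {p + q | p q. p \<in> P \<and> q \<in> Q}}"
    by (rule thin_system_exists[OF inf]) (rule that)
  define X where "X = {p + q | p q. p \<in> P \<and> q \<in> Q}"
  have XK: "X \<subseteq> K" unfolding X_def using D K(3) by blast
  have Kd: "x - y \<in> K" if "x \<in> K" "y \<in> K" for x y
    using K(3)[OF that(1) K(4)[OF that(2)]] by simp
  \<comment> \<open>\<open>Cl x\<close> is the union of the cosets \<open>x + K\<close> and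
    \<open>- x + K\<close>. These unions partition the group, and two elements whose sum is in
    \<open>K\<close> share a class.\<close>
  define Cl where "Cl x = {y. y - x \<in> K \<or> y + x \<in> K}" for x
  have Cl_countable: "countable (Cl x)" for x
  proof -
    have "Cl x \<subseteq> (\<lambda>k. k + x) ` K \<union> (\<lambda>k. k - x) ` K"
    proof
      fix y assume y: "y \<in> Cl x"
      have "y = (y - x) + x" "y = (y + x) - x" by simp_all
      with y show "y \<in> (\<lambda>k. k + x) ` K \<union> (\<lambda>k. k - x) ` K"
        unfolding Cl_def by blast
    qed
    then show ?thesis using K(1) by (meson countable_Un countable_image countable_subset)
  qed
  have Cl_sym: "x \<in> Cl y" if "y \<in> Cl x" for x y
    using that K(4)[of "y - x"] by (auto simp: Cl_def add.commute)
  have Cl_trans: "z \<in> Cl x" if "z \<in> Cl y" "y \<in> Cl x" for x y z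
  proof -
    have *: "z - x = (z - y) + (y - x)" "z + x = (z - y) + (y + x)"
      "z + x = (z + y) - (y - x)" "z - x = (z + y) - (y + x)" by (simp_all add: algebra_simps)
    from that consider "z - y \<in> K" "y - x \<in> K" | "z - y \<in> K" "y + x \<in> K"
      | "z + y \<in> K" "y - x \<in> K" | "z + y \<in> K" "y + x \<in> K" by (auto simp: Cl_def)
    then show ?thesis unfolding Cl_def mem_Collect_eq
      by cases (metis * K(3) Kd)+
  qed
  have Cl_eq: "Cl y = Cl x" if "y \<in> Cl x" for x y
    using that Cl_sym Cl_trans by blast
  \<comment> \<open>The choice is made as a function of the set \<open>M\<close>, so that equal
    classes \<open>Cl x = Cl x'\<close> receive the same piece of \<open>U\<close>.\<close>
  have "\<forall>M. countable M \<longrightarrow> (\<exists>U. U \<subseteq> (\<lambda>(z, t). z - t) ` (M \<times> T)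
      \<and> (\<forall>z\<in>M - X. \<exists>u\<in>U. \<exists>t\<in>T. z = u + t)
      \<and> (\<forall>u\<in>U. \<forall>d\<in>D. u + d \<notin> X) \<and> (\<forall>u\<in>U. \<forall>u'\<in>U. u + u' \<notin> X))"
  proof (intro allI impI)
    fix M :: "'a set" assume M: "countable M"
    obtain U where "U \<subseteq> (\<lambda>(z, t). z - t) ` (M \<times> T)" "\<And>z. z \<in> M - X \<Longrightarrow> \<exists>u\<in>U. \<exists>t\<in>T. z = u + t"
      "\<And>u d. u \<in> U \<Longrightarrow> d \<in> D \<Longrightarrow> u + d \<notin> X" "\<And>u u'. u \<in> U \<Longrightarrow> u' \<in> U \<Longrightarrow> u + u' \<notin> X"
      by (rule covering_set_avoiding_sums[OF infs(3) M thin[folded X_def]]) (assumption | rule that)+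
    then show "\<exists>U. U \<subseteq> (\<lambda>(z, t). z - t) ` (M \<times> T)
      \<and> (\<forall>z\<in>M - X. \<exists>u\<in>U. \<exists>t\<in>T. z = u + t)
      \<and> (\<forall>u\<in>U. \<forall>d\<in>D. u + d \<notin> X) \<and> (\<forall>u\<in>U. \<forall>u'\<in>U. u + u' \<notin> X)"
      by (intro exI[of _ U] conjI ballI)
  qed
  then obtain f where f: "\<And>M. countable M \<Longrightarrow> f M \<subseteq> (\<lambda>(z, t). z - t) ` (M \<times> T)
      \<and> (\<forall>z\<in>M - X. \<exists>u\<in>f M. \<exists>t\<in>T. z = u + t)
      \<and> (\<forall>u\<in>f M. \<forall>d\<in>D. u + d \<notin> X) \<and> (\<forall>u\<in>f M. \<forall>u'\<in>f M. u + u' \<notin> X)"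
    by metis
  note fC = f[OF Cl_countable]
  define U where "U = (\<Union>x. f (Cl x))"
  have in_Cl: "u \<in> Cl x" if "u \<in> f (Cl x)" for u x
  proof -
    obtain z t where zt: "z \<in> Cl x" "t \<in> T" "u = z - t"
      using fC[of x] \<open>u \<in> f (Cl x)\<close> by auto
    have "u - z \<in> K" using zt D K(4) by auto
    then have "u \<in> Cl z" by (simp add: Cl_def)
    with zt(1) show ?thesis using Cl_trans by blast
  qed
  have UD: "u + d \<notin> X" if "u \<in> U" "d \<in> D" for u d
    using fC that by (auto simp: U_def)
  have UU: "u + u' \<notin> X" if u: "u \<in> U" "u' \<in> U" for u u'
  proof
    assume X: "u + u' \<in> X"
    obtain x x' where x: "u \<in> f (Cl x)" "u' \<in> f (Cl x')" using u by (auto simp: U_def)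
    \<comment> \<open>Since \<open>X\<close> lies in \<open>K\<close>, both summands come from the
      same piece, whose own sums avoid \<open>X\<close>.\<close>
    have "u \<in> Cl u'" using X XK by (auto simp: Cl_def)
    then have "Cl x = Cl x'" using Cl_eq in_Cl x by metis
    with fC[of x] x X show False by auto
  qed
  define A where "A = D \<union> U"
  have "z \<in> hfold_sum 2 A" for z
  proof (cases "z \<in> X")
    case True
    then show ?thesis using D(1) by (auto simp: X_def A_def mem_hfold_sum_2)
  next
    case False
    moreover have "z \<in> Cl z" using K(2) by (simp add: Cl_def)
    ultimately obtain u t where "u \<in> f (Cl z)" "t \<in> T" "z = u + t" using fC by blast
    then show ?thesis using D(1) unfolding mem_hfold_sum_2 A_def U_def by blast
  qed
  then have basis: "hfold_sum 2 A = UNIV" by blast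
  have "\<not> hfold_sum 2 (A - {p}) \<sim>\<^sub>f UNIV" if p: "p \<in> P" for p
  proof -
    have "(+) p ` Q \<subseteq> - hfold_sum 2 (A - {p})"
    proof clarify
      fix q assume q: "q \<in> Q" and "p + q \<in> hfold_sum 2 (A - {p})"
      then obtain b b' where b: "b \<in> A - {p}" "b' \<in> A - {p}" "p + q = b + b'"
        by (auto simp: mem_hfold_sum_2)
      \<comment> \<open>Any sum in \<open>X\<close> with a summand in \<open>U\<close> is
        impossible, so both summands are in \<open>D\<close>, where \<open>p + q\<close> cannot be
        written without \<open>p\<close>. Both orders are needed because \<open>UD\<close> has the
        element of \<open>U\<close> first.\<close>
      have X: "b + b' \<in> X" "b' + b \<in> X" 
        unfolding add.commute[of b' b] b(3)[symmetric] X_def using p q by blast+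
      then have "b \<in> D" "b' \<in> D"
        using UD UU b unfolding A_def by blast+
      with uniq[OF p q] b show False by blast
    qed
    moreover have "infinite ((+) p ` Q)"
      using infs(2) by (simp add: finite_image_iff)
    ultimately show ?thesis
      using almost_eq_UNIV_iff finite_subset by metis
  qed
  then have "P \<subseteq> {a \<in> A. \<not> hfold_sum 2 (A - {a}) \<sim>\<^sub>f UNIV}"
    using D(1) by (auto simp: A_def)
  with infs(1) have "infinite {a \<in> A. \<not> hfold_sum 2 (A - {a}) \<sim>\<^sub>f UNIV}"
    using finite_subset by blast
  with basis that show ?thesis by blast
qed

section \<open>Orders and the value of S_fun\<close>

lemma hfold_sum_1: "hfold_sum 1 A = A"
  by (force simp: hfold_sum_def length_Suc_conv)

lemma hfold_sum_2_of_cofinite: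
  assumes inf: "infinite (UNIV :: 'a::ab_group_add set)" and A: "finite (- (A :: 'a set))"
  shows "hfold_sum 2 A = UNIV"
proof -
  have "z \<in> hfold_sum 2 A" for z
  proof -
    have "finite (- A \<union> (\<lambda>x. z - x) ` (- A))" using A by simp
    then obtain a where a: "a \<notin> - A \<union> (\<lambda>x. z - x) ` (- A)"
      using inf ex_new_if_finite by blast
    have "z - a \<in> A"
    proof (rule ccontr)
      assume "z - a \<notin> A"
      then have "z - (z - a) \<in> (\<lambda>x. z - x) ` (- A)" by blast
      with a show False by simp
    qed
    moreover have "a \<in> A" "z = a + (z - a)" using a by auto
    ultimately show ?thesis unfolding mem_hfold_sum_2 by blast
  qed
  then show ?thesis by blast
qed

text \<open>Failure at \<open>k = 2\<close> also excludes \<open>k = 1\<close>: a cofinite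
  \<open>A\<close> meets every reflected set \<open>z - A\<close>, so that \<open>2A\<close> would
  be the whole group.\<close>

lemma ord_star_ge_3:
  assumes inf: "infinite (UNIV :: 'a::ab_group_add set)" and "\<not> hfold_sum 2 (A :: 'a set) \<sim>\<^sub>f UNIV"
  shows "ord_star A \<ge> 3"
  unfolding ord_star_def
proof (rule Inf_greatest, clarify)
  fix k :: nat assume k: "0 < k" "hfold_sum k A \<sim>\<^sub>f UNIV"
  have "k \<noteq> 2" using assms k by auto
  moreover have "k \<noteq> 1"
  proof
    assume "k = 1"
    then have "finite (- A)"
      using k(2) hfold_sum_1[of A] by (simp add: almost_eq_UNIV_iff)
    with assms hfold_sum_2_of_cofinite show False
      by (metis almost_eq_UNIV_iff Compl_UNIV_eq finite.emptyI)
  qed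
  ultimately have "3 \<le> k" using k by linarith
  then show "3 \<le> enat k" by (simp add: numeral_eq_enat)
qed

theorem theorem1p8:
  assumes "infinite (UNIV :: 'a::ab_group_add set)"
  shows "S_fun TYPE('a) 2 = 3"
proof (rule antisym)
  have "finite {a \<in> A. ord_star (A - {a}) > enat 3}" if "hfold_sum 2 A \<sim>\<^sub>f UNIV" for A :: "'a set"
  proof (rule finite_subset[OF _ finite_not_three_basis[OF assms that]], clarify)
    fix a assume "ord_star (A - {a}) > enat 3" "hfold_sum 3 (A - {a}) \<sim>\<^sub>f UNIV"
    moreover from this have "ord_star (A - {a}) \<le> enat 3"
      unfolding ord_star_def by (intro Inf_lower) auto
    ultimately show False by simp
  qed
  then have "S_fun TYPE('a) 2 \<le> enat 3"
    unfolding S_fun_def by (intro Inf_lower) blast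
  then show "S_fun TYPE('a) 2 \<le> 3" by (simp add: numeral_eq_enat)
next
  obtain A :: "'a set" where A: "hfold_sum 2 A = UNIV"
    "infinite {a \<in> A. \<not> hfold_sum 2 (A - {a}) \<sim>\<^sub>f UNIV}"
    by (rule two_basis_with_infinitely_many_essential[OF assms])
  show "3 \<le> S_fun TYPE('a) 2"
    unfolding S_fun_def
  proof (rule Inf_greatest, clarify)
    fix s :: nat
    assume s: "\<forall>A :: 'a set. hfold_sum 2 A \<sim>\<^sub>f UNIV \<longrightarrow> finite {a \<in> A. ord_star (A - {a}) > enat s}"
    show "3 \<le> enat s"
    proof (rule ccontr)
      assume "\<not> 3 \<le> enat s"
      then have lt: "enat s < 3" by (simp only: not_le)
      have "{a \<in> A. \<not> hfold_sum 2 (A - {a}) \<sim>\<^sub>f UNIV} \<subseteq> {a \<in> A. ord_star (A - {a}) > enat s}"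
        using ord_star_ge_3[OF assms] less_le_trans[OF lt] by blast
      moreover have "finite {a \<in> A. ord_star (A - {a}) > enat s}"
        using s A(1) by (simp add: almost_eq_UNIV_iff)
      ultimately show False using A(2) finite_subset by blast
    qed
  qed
qed

end
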